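(* For every integer $n\ge 0$, \begin{align*} H_{9n}(F(x,9))&=H_{9n+1}(F(x,9))=1, \\ H_{9n+2}(F(x,9))&=-\tfrac{27}{10}( 3n+2 )( 18n+1 )( n+1 )( 54n^{2}+42n+5 ),\\ H_{9n+3}(F(x,9))&=\tfrac{9}{20} ( n+1 ) ^{2} ( 26244n^{4}+104976n^{3}+108459n^{2}+31266n-1460 ),\\ H_{9n+4}(F(x,9))&=-H_{9n+6}(F(x,9))=\left(9( n+1) \right) ^{3},\\ H_{9n+5}(F(x,9))&=0,\\ H_{9n+7}(F(x,9))&=\tfrac{9}{20} ( n+1 ) ^{2} ( 26244n^{4}+104976n^{3}+108459n^{2}-17334n-50060 ),\\ H_{9n+8}(F(x,9))&=\tfrac{27}{10} ( 18n+35 )( 3n+4 )( n+1 )( 54n^{2}+174n+137 ). \end{align*}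
   Context: For a power series $A(x)=\sum_{n\ge 0}a_nx^n$, the Hankel determinants are $H_n(A(x))=\det(a_{i+j})_{0\le i,j\le n-1}$ for $n\ge 1$, with $H_0(A(x))=1$. Let $C(x)=\sum_{n\ge0}C_nx^n$ with $C_n=\frac1{n+1}\binom{2n}{n}$ be the Catalan generating function (the unique power series with $C(x)=1+xC(x)^2$), and $F(x,r)=C(x)^r=\sum_{n\ge 0}\frac{r}{2n+r}\binom{2n+r}{n}x^n$ for positive integers $r$. *)

theory Defs
  imports
    "HOL-Computational_Algebra.Formal_Power_Series"
    "Jordan_Normal_Form.Determinant"
begin

definition catalan_fps :: "rat fps" where
  "catalan_fps = Abs_fps (\<lambda>n. of_nat ((2 * n) choose n) / of_nat (n + 1))"

definition F :: "nat \<Rightarrow> rat fps" where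
  "F r = catalan_fps ^ r"

(* For n = 0 this is the determinant of the empty matrix, which is 1. *)
definition hankel_det :: "nat \<Rightarrow> 'a::comm_ring_1 fps \<Rightarrow> 'a" where
  "hankel_det n A = det (mat n n (\<lambda>(i, j). fps_nth A (i + j)))"

lemma hankel_det_0: "hankel_det 0 A = 1"
  by (simp add: hankel_det_def det_def)

end

theory Submission
  imports Defs
begin

text \<open>
Let \<open>L\<close> be the linear functional on polynomials whose moments are the Catalan numbers, and let
\<open>p\<^sub>k\<close> (\<open>catpoly\<close>) be its monic orthogonal polynomials.  They are Chebyshev polynomials in disguise,
\<open>p\<^sub>k(2 + 2 cos \<phi>) = sin ((2k + 1) \<phi>/2) / sin (\<phi>/2)\<close>, and the three-term recurrence gives the
generating function of \<open>L(x\<^sup>n p\<^sub>k)\<close> in closed form, \<open>z^k C(z)^(2k + 1)\<close>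
(\<open>catalan_functional_catpoly\<close>).  For \<open>k = 4\<close> this says that the coefficients of the ninth power of
\<open>C\<close> are the moments of the functional \<open>f \<mapsto> L(q f)\<close> with the weight polynomial \<open>q = x\<^sup>4 p\<^sub>4\<close>.

The Hankel determinants of \<open>L\<close> itself are all 1, and passing from \<open>L\<close> to \<open>L(q \<cdot>)\<close> is governed by
Christoffel's formula (\<open>christoffel_hankel_det\<close>): the Hankel determinant of order \<open>n\<close> equals the
\<open>8 \<times> 8\<close> determinant of the coordinates, in the eight-dimensional quotient by \<open>q\<close>, of any eight monic
polynomials of degrees \<open>n, \<dots>, n + 7\<close> that \<open>L\<close> annihilates against all polynomials of degree
below \<open>n\<close>.

Coordinates in the quotient are taken modulo \<open>p\<^sub>4\<close> and modulo \<open>x\<^sup>4\<close> separately.  Modulo \<open>p\<^sub>4\<close> the sequence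
\<open>p\<^sub>k\<close> has period 9, because \<open>9\<phi>\<close> is a multiple of \<open>2\<pi>\<close> at the roots of \<open>p\<^sub>4\<close>; moreover it is
antisymmetric about \<open>k = 9m + 4\<close> (\<open>catpoly_period\<close>, \<open>catpoly_reflect\<close>).  Modulo \<open>x\<^sup>4\<close> the coefficients
of \<open>p\<^sub>k\<close> are, up to sign, polynomials in \<open>k\<close>.  This is why the determinants depend on \<open>n\<close> modulo 9
and are polynomials in \<open>n div 9\<close>.  In every residue class the eight polynomials can be chosen so that
four of them are multiples of \<open>p\<^sub>4\<close> and the other four reduce to distinct \<open>\<plusminus>p\<^sub>i\<close>, \<open>i < 4\<close>; only a
sparse \<open>4 \<times> 4\<close> determinant of low-order coefficients remains (\<open>hankel_det_F_9\<close>).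
\<close>

section \<open>Hankel determinants of a polynomial multiple of a functional\<close>

definition linear_functional :: "('a::comm_ring_1 poly \<Rightarrow> 'a) \<Rightarrow> bool" where
  "linear_functional \<phi> \<longleftrightarrow>
     (\<forall>f g. \<phi> (f + g) = \<phi> f + \<phi> g) \<and> (\<forall>a f. \<phi> (smult a f) = a * \<phi> f)"

lemma linear_functional_0:
  assumes "linear_functional \<phi>"
  shows "\<phi> 0 = 0"
  using assms unfolding linear_functional_def by (metis mult_zero_left smult_0_left)

lemma linear_functional_sum:
  assumes "linear_functional \<phi>"
  shows "\<phi> (\<Sum>i\<in>A. smult (a i) (f i)) = (\<Sum>i\<in>A. a i * \<phi> (f i))"
proof (induction A rule: infinite_finite_induct)
  case (insert i A)
  then show ?case
    using assms by (simp add: linear_functional_def)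
qed (simp_all add: linear_functional_0[OF assms])

lemma linear_functional_eq_sum_monom:
  assumes "linear_functional \<phi>" "degree f < N"
  shows "\<phi> f = (\<Sum>i<N. coeff f i * \<phi> (monom 1 i))"
proof -
  have "f = (\<Sum>i<N. smult (coeff f i) (monom 1 i))"
    using assms(2) by (intro poly_eqI) (auto simp: coeff_sum if_distrib coeff_eq_0 cong: if_cong)
  then have "\<phi> f = \<phi> (\<Sum>i<N. smult (coeff f i) (monom 1 i))"
    by simp
  then show ?thesis
    by (simp only: linear_functional_sum[OF assms(1)])
qed

text \<open>
The matrix on the left is the unitriangular matrix of coefficients of the \<open>g k\<close> times the matrix of
values on monomials.  In particular two monic families with the same degrees give the same determinant.
\<close>

lemma det_functionals_monic:
  fixes \<phi> :: "nat \<Rightarrow> 'a::idom poly \<Rightarrow> 'a"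
  assumes lin: "\<And>l. l < N \<Longrightarrow> linear_functional (\<phi> l)"
    and monic: "\<And>k. k < N \<Longrightarrow> degree (g k) = k \<and> coeff (g k) k = 1"
  shows "det (mat N N (\<lambda>(k, l). \<phi> l (g k))) = det (mat N N (\<lambda>(k, l). \<phi> l (monom 1 k)))"
proof -
  let ?C = "mat N N (\<lambda>(k, i). coeff (g k) i)" and ?M = "mat N N (\<lambda>(k, l). \<phi> l (monom 1 k))"
  have "mat N N (\<lambda>(k, l). \<phi> l (g k)) = ?C * ?M"
  proof (rule eq_matI)
    fix k l assume "k < dim_row (?C * ?M)" "l < dim_col (?C * ?M)"
    then show "mat N N (\<lambda>(k, l). \<phi> l (g k)) $$ (k, l) = (?C * ?M) $$ (k, l)"
      using linear_functional_eq_sum_monom[OF lin, of l "g k" N] monic[of k]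
      by (simp add: scalar_prod_def lessThan_atLeast0)
  qed auto
  moreover have "det ?C = prod_list (diag_mat ?C)"
    using monic by (intro det_lower_triangular[where n = N]) (auto simp: coeff_eq_0)
  moreover have "prod_list (diag_mat ?C) = 1"
    using monic by (simp add: prod_list_diag_prod)
  ultimately show ?thesis
    by (simp add: det_mult[of _ N])
qed

text \<open>
A form of Christoffel's formula for a functional multiplied by a polynomial \<open>q\<close>, where the \<open>\<rho> l\<close> play
the role of coordinates modulo \<open>q\<close>.  Take the \<open>n + d\<close> functionals \<open>f \<mapsto> L(x\<^sup>l f)\<close>, \<open>l < n\<close>, and
\<open>\<rho> l\<close>, \<open>l < d\<close>.  On the family \<open>p\<close> orthogonality makes their matrix block triangular with a
unitriangular block; on the family \<open>e 0, \<dots>, e (d - 1), q, x q, \<dots>\<close> the Hankel matrix of \<open>L(q \<cdot>)\<close>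
appears.  Both families are monic with the same degrees, so the two determinants agree.  Since only
products with \<open>x\<^sup>l\<close>, \<open>l < n\<close>, enter, the \<open>p k\<close> with \<open>k \<ge> n\<close> can be chosen to have simple coordinates.
\<close>

lemma christoffel_hankel_det:
  fixes L :: "'a::idom poly \<Rightarrow> 'a"
  assumes L: "linear_functional L"
    and \<rho>: "\<And>l. l < d \<Longrightarrow> linear_functional (\<rho> l)"
    and vanish: "\<And>l f. l < d \<Longrightarrow> \<rho> l (f * q) = 0"
    and q: "degree q = d" "coeff q d = 1"
    and p: "\<And>k. k < n + d \<Longrightarrow> degree (p k) = k \<and> coeff (p k) k = 1"
    and orth: "\<And>k l. k < n + d \<Longrightarrow> l < n \<Longrightarrow> l < k \<Longrightarrow> L (monom 1 l * p k) = 0"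
    and norm: "\<And>k. k < n \<Longrightarrow> L (monom 1 k * p k) = 1"
    and e: "\<And>k. k < d \<Longrightarrow> degree (e k) = k \<and> coeff (e k) k = 1"
  shows "det (mat d d (\<lambda>(i, l). \<rho> l (p (n + i)))) =
    (-1) ^ (d * n) * det (mat d d (\<lambda>(i, l). \<rho> l (e i))) *
    hankel_det n (Abs_fps (\<lambda>i. L (monom 1 i * q)))"
proof -
  define \<phi> where "\<phi> l = (if l < n then (\<lambda>f. L (monom 1 l * f)) else \<rho> (l - n))" for l
  define f where "f k = (if k < d then e k else monom 1 (k - d) * q)" for k
  let ?N = "n + d"
  let ?R = "mat d d (\<lambda>(i, l). \<rho> l (p (n + i)))" and ?D = "mat d d (\<lambda>(i, l). \<rho> l (e i))"
  let ?H = "mat n n (\<lambda>(i, j). L (monom 1 (i + j) * q))"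
  have lin: "linear_functional (\<phi> l)" if "l < ?N" for l
    using that L \<rho>[of "l - n"] unfolding \<phi>_def linear_functional_def
    by (auto simp: distrib_left)
  have f: "degree (f k) = k \<and> coeff (f k) k = 1" if "k < ?N" for k
  proof (cases "k < d")
    case False
    have "q \<noteq> 0"
      using q by auto
    then have "degree (monom 1 (k - d) * q) = k"
      using False q by (simp add: degree_mult_eq degree_monom_eq)
    then show ?thesis
      using False q by (simp add: f_def coeff_monom_mult)
  qed (use e in \<open>auto simp: f_def\<close>)
  \<comment> \<open>The orthogonality relations annihilate the lower left block.\<close>
  have P: "det (mat ?N ?N (\<lambda>(k, l). \<phi> l (p k))) = det ?R"
  proof -
    let ?U = "mat n n (\<lambda>(k, l). L (monom 1 l * p k))"
    have "mat ?N ?N (\<lambda>(k, l). \<phi> l (p k)) =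
      four_block_mat ?U (mat n d (\<lambda>(k, l). \<rho> l (p k))) (0\<^sub>m d n) ?R"
      by (rule eq_matI) (auto simp: \<phi>_def orth)
    then have "det (mat ?N ?N (\<lambda>(k, l). \<phi> l (p k))) = det ?U * det ?R"
      by (simp add: det_four_block_mat_lower_left_zero[of _ n _ d])
    moreover have "det ?U = prod_list (diag_mat ?U)"
      by (rule det_upper_triangular[where n = n]) (auto simp: orth)
    ultimately show ?thesis
      by (simp add: prod_list_diag_prod norm)
  qed
  \<comment> \<open>The sign comes from moving the \<open>n\<close> rows of multiples of \<open>q\<close> above the \<open>d\<close> rows of the \<open>e k\<close>.\<close>
  have Q: "det (mat ?N ?N (\<lambda>(k, l). \<phi> l (f k))) = (-1) ^ (d * n) * (det ?H * det ?D)"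
  proof -
    have "mat ?N ?N (\<lambda>(i, j). mat ?N ?N (\<lambda>(k, l). \<phi> l (f k)) $$
        (if i < n then i + d else if i < d + n then i - n else i, j)) =
      four_block_mat ?H (0\<^sub>m n d) (mat d n (\<lambda>(k, l). L (monom 1 l * e k))) ?D"
      by (rule eq_matI)
         (auto simp: \<phi>_def f_def vanish mult.assoc[symmetric] mult_monom add.commute)
    then have "det (mat ?N ?N (\<lambda>(i, j). mat ?N ?N (\<lambda>(k, l). \<phi> l (f k)) $$
        (if i < n then i + d else if i < d + n then i - n else i, j))) = det ?H * det ?D"
      by (simp add: det_four_block_mat_upper_right_zero[of _ n _ d])
    then show ?thesis
      by (subst det_swap_initial_rows[where k = d and n = n and m = ?N]) auto
  qed
  have "det ?R = (-1) ^ (d * n) * (det ?H * det ?D)"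
    using det_functionals_monic[of ?N \<phi> p, OF lin p] det_functionals_monic[of ?N \<phi> f, OF lin f] P Q
    by simp
  then show ?thesis
    by (simp add: hankel_det_def mult_ac)
qed

section \<open>Laplace expansion of determinants given by lists\<close>

definition list_det :: "'a::comm_ring_1 list list \<Rightarrow> 'a" where
  "list_det M = det (mat (length M) (length M) (\<lambda>(i, j). M ! i ! j))"

text \<open>
The part of the Laplace expansion along the first column that is contributed by the rows \<open>M\<close>, when
the rows above them have already been passed and are kept in \<open>P\<close> with their first entry removed; the
sign is normalised so that the first row of \<open>M\<close> counts positively.
\<close>

definition column_expansion :: "'a::comm_ring_1 list list \<Rightarrow> 'a list list \<Rightarrow> 'a" where
  "column_expansion P M = (\<Sum>i<length M. (-1) ^ i * hd (M ! i) *
     list_det (P @ map tl (take i M @ drop (Suc i) M)))"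

lemma column_expansion_Nil: "column_expansion P [] = 0"
  by (simp add: column_expansion_def)

lemma column_expansion_Cons:
  "column_expansion P ((a # r) # M) = a * list_det (P @ map tl M) - column_expansion (P @ [r]) M"
  by (simp add: column_expansion_def sum.lessThan_Suc_shift sum_negf[symmetric] del: sum.lessThan_Suc)

text \<open>
The case of a zero entry is separated because it creates no minor.  Thus rewriting expands a determinant
whose first columns have a single nonzero entry without any branching.
\<close>

lemma column_expansion_Cons_0:
  "column_expansion P ((0 # r) # M) = - column_expansion (P @ [r]) M"
  by (simp add: column_expansion_Cons)

lemma list_det_Nil: "list_det [] = 1"
  by (simp add: list_det_def)

lemma list_det_expand:
  assumes "M \<noteq> []" "list_all (\<lambda>r. length r = length M) M"
  shows "list_det M = column_expansion [] M"
proof -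
  let ?n = "length M" and ?A = "mat (length M) (length M) (\<lambda>(i, j). M ! i ! j)"
  have n: "0 < ?n"
    using assms by simp
  have "list_det M = (\<Sum>i<?n. ?A $$ (i, 0) * cofactor ?A i 0)"
    unfolding list_det_def by (rule laplace_expansion_column[where n = ?n]) (use n in auto)
  also have "\<dots> = column_expansion [] M"
    unfolding column_expansion_def
  proof (rule sum.cong[OF refl])
    fix i assume "i \<in> {..<?n}"
    then have i: "i < ?n"
      by simp
    let ?M = "map tl (take i M @ drop (Suc i) M)"
    have len: "length ?M = ?n - 1"
      using i by simp
    have entry: "?M ! a ! b = M ! (insert_index i a) ! Suc b" if "a < ?n - 1" "b < ?n - 1" for a b
    proof -
      have "?M ! a = tl (M ! insert_index i a)"
        using that i by (auto simp: nth_append insert_index_def)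
      moreover have "insert_index i a < ?n"
        using that by (auto simp: insert_index_def)
      then have "length (M ! insert_index i a) = ?n"
        using assms by (simp add: list_all_length)
      ultimately show ?thesis
        using that by (simp add: nth_tl)
    qed
    have "mat_delete ?A i 0 = mat (?n - 1) (?n - 1) (\<lambda>(a, b). ?M ! a ! b)"
    proof (rule eq_matI)
      fix a b
      assume "a < dim_row (mat (?n - 1) (?n - 1) (\<lambda>(a, b). ?M ! a ! b))"
        and "b < dim_col (mat (?n - 1) (?n - 1) (\<lambda>(a, b). ?M ! a ! b))"
      then show "mat_delete ?A i 0 $$ (a, b) = mat (?n - 1) (?n - 1) (\<lambda>(a, b). ?M ! a ! b) $$ (a, b)"
        using i entry[of a b] by (auto simp: mat_delete_def insert_index_def)
    qed (auto simp: mat_delete_def)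
    then have "det (mat_delete ?A i 0) = list_det ([] @ ?M)"
      using len by (simp add: list_det_def)
    moreover have "length (M ! i) = ?n"
      using assms(2) i by (simp add: list_all_length)
    then have "hd (M ! i) = M ! i ! 0"
      using n by (intro hd_conv_nth) auto
    ultimately show "?A $$ (i, 0) * cofactor ?A i 0 = (- 1) ^ i * hd (M ! i) * list_det ([] @ ?M)"
      using i n by (simp add: cofactor_def)
  qed
  finally show ?thesis .
qed

lemmas list_det_simps = list_det_expand list_det_Nil column_expansion_Nil column_expansion_Cons
  column_expansion_Cons_0 list.pred_inject length_Cons list.size(3) append.simps list.map list.sel
  list.distinct simp_thms mult_1_left mult_1_right mult_zero_left mult_zero_right
  mult_minus_left mult_minus_right diff_0 diff_0_right minus_zero minus_minus

section \<open>Catalan moments\<close>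

lemma catalan_nth_Suc:
  "of_nat (n + 2) * fps_nth catalan_fps (Suc n) = of_nat (4 * n + 2) * fps_nth catalan_fps n"
proof -
  have central: "of_nat (2 * n choose n) = (fact (2 * n) / (fact n * fact n) :: rat)" for n
    by (subst binomial_fact) (auto simp: mult_2)
  have "fact (2 * Suc n) = (of_nat (2 * n + 2) * of_nat (2 * n + 1) * fact (2 * n) :: rat)"
    by (simp add: algebra_simps)
  then have "of_nat (n + 1) * of_nat (2 * Suc n choose Suc n) =
      (of_nat (4 * n + 2) * of_nat (2 * n choose n) :: rat)"
    unfolding central by (simp add: divide_simps) (simp add: algebra_simps)
  then show ?thesis
    by (simp add: catalan_fps_def divide_simps del: binomial_Suc_Suc mult_Suc_right)
       (simp add: algebra_simps del: binomial_Suc_Suc mult_Suc_right)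
qed

text \<open>
The ratio of consecutive Catalan numbers amounts to a linear differential equation for \<open>S = 1 - 2xC\<close>, namely
\<open>(1 - 4x) S' = -2 S\<close>, the equation of \<open>sqrt (1 - 4x)\<close>.  Hence \<open>T = S\<^sup>2\<close> satisfies
\<open>(1 - 4x) T' = -4 T\<close>, whose solution with constant term 1 is \<open>1 - 4x\<close>; expanding \<open>S\<^sup>2\<close> gives the claim.
\<close>

lemma catalan_quadratic: "catalan_fps = 1 + fps_X * catalan_fps ^ 2"
proof -
  define S where "S = 1 - fps_const 2 * (fps_X * catalan_fps)"
  define T where "T = S * S"
  have S0: "fps_nth S 0 = 1" and S_Suc: "fps_nth S (Suc n) = - 2 * fps_nth catalan_fps n" for n
    by (simp_all add: S_def)
  have ode: "fps_deriv S - fps_const 4 * (fps_X * fps_deriv S) = - (fps_const 2 * S)"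
  proof (rule fps_ext)
    fix n
    show "fps_nth (fps_deriv S - fps_const 4 * (fps_X * fps_deriv S)) n =
        fps_nth (- (fps_const 2 * S)) n"
    proof (cases n)
      case 0
      then show ?thesis
        by (simp add: S0 S_Suc catalan_fps_def)
    next
      case (Suc k)
      then show ?thesis
        using catalan_nth_Suc[of k] by (simp add: S_Suc) (simp add: algebra_simps)
    qed
  qed
  have "fps_deriv T - fps_const 4 * (fps_X * fps_deriv T) =
      S * (fps_deriv S - fps_const 4 * (fps_X * fps_deriv S)) +
      (fps_deriv S - fps_const 4 * (fps_X * fps_deriv S)) * S"
    by (simp add: T_def algebra_simps)
  also have "\<dots> = - ((fps_const 2 + fps_const 2) * (S * S))"
    unfolding ode by (simp only: mult_minus_left mult_minus_right minus_add_distrib algebra_simps)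
  also have "\<dots> = - (fps_const 4 * T)"
    by (simp add: T_def)
  finally have coeffs: "fps_nth (fps_deriv T - fps_const 4 * (fps_X * fps_deriv T)) n =
      fps_nth (- (fps_const 4 * T)) n" for n
    by simp
  have T0: "fps_nth T 0 = 1"
    by (simp add: T_def S0)
  have T1: "fps_nth T (Suc 0) = - 4"
    using coeffs[of 0] T0 by simp
  have T2: "fps_nth T (Suc (Suc n)) = 0" for n
  proof (induction n)
    case 0
    then show ?case
      using coeffs[of 1] by simp
  next
    case (Suc n)
    have "(1 + (1 + (1 + rat_of_nat n))) \<noteq> 0"
      by (metis of_nat_Suc of_nat_neq_0)
    then show ?case
      using coeffs[of "Suc (Suc n)"] Suc by simp
  qed
  have "T = 1 - fps_const 4 * fps_X"
  proof (rule fps_ext)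
    fix n
    show "fps_nth T n = fps_nth (1 - fps_const 4 * fps_X) n"
      by (cases n; cases "n - 1") (auto simp: T0 T1 T2)
  qed
  then have "fps_const 4 * (fps_X * (1 + fps_X * catalan_fps ^ 2 - catalan_fps)) = 0"
    by (simp add: T_def S_def algebra_simps power2_eq_square flip: numeral_fps_const)
  then have "1 + fps_X * catalan_fps ^ 2 - catalan_fps = 0"
    by (simp only: mult_eq_0_iff fps_X_neq_zero fps_const_eq_0_iff) simp
  then show ?thesis
    by (metis eq_iff_diff_eq_0)
qed

lemma catalan_minus_1: "catalan_fps - 1 = fps_X * catalan_fps ^ 2"
  by (metis add_diff_cancel_left' catalan_quadratic)

definition catalan_functional :: "rat poly \<Rightarrow> rat" where
  "catalan_functional f = (\<Sum>i\<le>degree f. coeff f i * fps_nth catalan_fps i)"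

lemma catalan_functional_eq:
  assumes "degree f \<le> N"
  shows "catalan_functional f = (\<Sum>i\<le>N. coeff f i * fps_nth catalan_fps i)"
  unfolding catalan_functional_def
  by (rule sum.mono_neutral_left) (use assms in \<open>auto simp: coeff_eq_0\<close>)

lemma linear_catalan_functional: "linear_functional catalan_functional"
  unfolding linear_functional_def
proof (intro conjI allI)
  fix f g :: "rat poly" and a
  let ?N = "max (degree f) (degree g)"
  show "catalan_functional (f + g) = catalan_functional f + catalan_functional g"
    by (simp add: catalan_functional_eq[of _ ?N] degree_add_le algebra_simps sum.distrib)
  show "catalan_functional (smult a f) = a * catalan_functional f"
    by (simp add: catalan_functional_eq[of _ "degree f"] degree_smult_le sum_distrib_left mult.assoc)
qed

lemma catalan_functional_add: "catalan_functional (f + g) = catalan_functional f + catalan_functional g"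
  and catalan_functional_smult: "catalan_functional (smult a f) = a * catalan_functional f"
  using linear_catalan_functional by (simp_all add: linear_functional_def)

lemma catalan_functional_monom: "catalan_functional (monom 1 n) = fps_nth catalan_fps n"
  by (simp add: catalan_functional_def degree_monom_eq if_distrib[of "\<lambda>x. x * _"] cong: if_cong)

text \<open>
These are the Chebyshev polynomials of the fourth kind in the variable \<open>x = 2 + 2 cos \<phi>\<close>:
\<open>catpoly k\<close> is \<open>sin ((2k + 1) \<phi>/2) / sin (\<phi>/2)\<close>.
\<close>

fun catpoly :: "nat \<Rightarrow> rat poly" where
  "catpoly 0 = 1"
| "catpoly (Suc 0) = [:- 1, 1:]"
| "catpoly (Suc (Suc k)) = [:- 2, 1:] * catpoly (Suc k) - catpoly k"

lemma catpoly_monic: "degree (catpoly k) = k \<and> coeff (catpoly k) k = 1"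
proof (induction k rule: catpoly.induct)
  case (3 k)
  have "degree ([:- 2, 1:] * catpoly (Suc k)) = Suc (Suc k)"
    using 3 by (subst degree_mult_eq) auto
  then have "degree (catpoly (Suc (Suc k))) = Suc (Suc k)"
    using 3 unfolding catpoly.simps diff_conv_add_uminus
    by (subst degree_add_eq_left) (simp_all del: mult_pCons_left)
  then show ?case
    using 3 by (simp add: coeff_eq_0)
qed auto

text \<open>
The three-term recurrence for \<open>catpoly\<close> translates, for the generating functions
\<open>G\<^sub>k = \<Sum> L(x\<^sup>n p\<^sub>k) z\<^sup>n\<close>, into \<open>G\<^sub>k\<^sub>+\<^sub>2 = G\<^sub>k\<^sub>+\<^sub>1/z - 2 G\<^sub>k\<^sub>+\<^sub>1 - G\<^sub>k\<close> up to the constant term.  The right side of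
the claim solves it because \<open>C\<^sup>2 - 2zC\<^sup>2 - 1 = (C - 1)\<^sup>2 = (zC\<^sup>2)\<^sup>2\<close>.  The factor \<open>z\<^sup>k\<close> contains the
orthogonality relations below.
\<close>

lemma catalan_functional_catpoly:
  "catalan_functional (monom 1 n * catpoly k) =
     fps_nth (fps_X ^ k * catalan_fps ^ (2 * k + 1)) n"
proof (induction k arbitrary: n rule: catpoly.induct)
  case 1
  show ?case
    by (simp add: catalan_functional_monom)
next
  case 2
  have "monom 1 n * catpoly (Suc 0) = monom 1 (Suc n) + smult (- 1) (monom 1 n)"
    by (simp add: monom_Suc)
  then have "catalan_functional (monom 1 n * catpoly (Suc 0)) =
      fps_nth catalan_fps (Suc n) - fps_nth catalan_fps n"
    by (simp only: catalan_functional_add catalan_functional_smult catalan_functional_monom)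
  also have "fps_nth catalan_fps (Suc n) = fps_nth (catalan_fps - 1) (Suc n)"
    by simp
  also have "\<dots> = fps_nth (catalan_fps ^ 2) n"
    by (simp only: catalan_minus_1) simp
  also have "fps_nth (catalan_fps ^ 2) n - fps_nth catalan_fps n =
      fps_nth (catalan_fps ^ 2 - catalan_fps) n"
    by simp
  also have "catalan_fps ^ 2 - catalan_fps = catalan_fps * (catalan_fps - 1)"
    by (simp add: algebra_simps power2_eq_square)
  also have "catalan_fps - 1 = fps_X * catalan_fps ^ 2"
    by (rule catalan_minus_1)
  finally show ?case
    by (simp add: eval_nat_numeral mult_ac)
next
  case (3 k)
  let ?C = catalan_fps
  have "monom 1 n * catpoly (Suc (Suc k)) =
      monom 1 (Suc n) * catpoly (Suc k) +
      (smult (- 2) (monom 1 n * catpoly (Suc k)) + smult (- 1) (monom 1 n * catpoly k))"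
    by (simp add: monom_Suc algebra_simps)
  then have "catalan_functional (monom 1 n * catpoly (Suc (Suc k))) =
      fps_nth (fps_X ^ Suc k * ?C ^ (2 * Suc k + 1)) (Suc n) -
      2 * fps_nth (fps_X ^ Suc k * ?C ^ (2 * Suc k + 1)) n -
      fps_nth (fps_X ^ k * ?C ^ (2 * k + 1)) n"
    using 3 by (simp only: catalan_functional_add catalan_functional_smult)
  also have "fps_nth (fps_X ^ Suc k * ?C ^ (2 * Suc k + 1)) (Suc n) =
      fps_nth (fps_X ^ k * ?C ^ (2 * Suc k + 1)) n"
    by (simp only: power_Suc mult.assoc fps_X_mult_nth) simp
  also have "fps_nth (fps_X ^ k * ?C ^ (2 * Suc k + 1)) n -
      2 * fps_nth (fps_X ^ Suc k * ?C ^ (2 * Suc k + 1)) n -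
      fps_nth (fps_X ^ k * ?C ^ (2 * k + 1)) n =
      fps_nth (fps_X ^ k * ?C ^ (2 * Suc k + 1) -
        fps_const 2 * (fps_X ^ Suc k * ?C ^ (2 * Suc k + 1)) - fps_X ^ k * ?C ^ (2 * k + 1)) n"
    by (simp only: fps_sub_nth fps_mult_left_const_nth)
  also have "fps_X ^ k * ?C ^ (2 * Suc k + 1) -
        fps_const 2 * (fps_X ^ Suc k * ?C ^ (2 * Suc k + 1)) - fps_X ^ k * ?C ^ (2 * k + 1) =
      fps_X ^ k * ?C ^ (2 * k + 1) * (?C ^ 2 - 2 * (fps_X * ?C ^ 2) - 1)"
    by (simp add: algebra_simps power2_eq_square flip: numeral_fps_const)
  also have "?C ^ 2 - 2 * (fps_X * ?C ^ 2) - 1 = (?C - 1) * (?C - 1)"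
    unfolding catalan_minus_1[symmetric] by (simp add: algebra_simps power2_eq_square)
  also have "?C - 1 = fps_X * ?C ^ 2"
    by (rule catalan_minus_1)
  finally show ?case
    by (simp add: algebra_simps power_add power2_eq_square)
qed

lemma catpoly_orthogonal: "l < k \<Longrightarrow> catalan_functional (monom 1 l * catpoly k) = 0"
  by (simp add: catalan_functional_catpoly fps_X_power_mult_nth del: power_Suc)

lemma catpoly_norm: "catalan_functional (monom 1 k * catpoly k) = 1"
proof -
  have "fps_nth catalan_fps 0 = 1"
    by (simp add: catalan_fps_def)
  then show ?thesis
    by (simp add: catalan_functional_catpoly fps_X_power_mult_nth fps_power_zeroth del: power_Suc)
qed

text \<open>
The case \<open>k = 4\<close>: shifting \<open>n\<close> by 4 removes the factor \<open>z\<^sup>4\<close> in front of the ninth power of \<open>C\<close>.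
\<close>

lemma F_eq_functional: "F 9 = Abs_fps (\<lambda>i. catalan_functional (monom 1 i * (monom 1 4 * catpoly 4)))"
proof (rule fps_ext)
  fix i
  have "catalan_functional (monom 1 (i + 4) * catpoly 4) = fps_nth (catalan_fps ^ 9) i"
    by (simp add: catalan_functional_catpoly fps_X_power_mult_nth)
  then show "fps_nth (F 9) i =
      fps_nth (Abs_fps (\<lambda>i. catalan_functional (monom 1 i * (monom 1 4 * catpoly 4)))) i"
    by (simp add: F_def mult.assoc[symmetric] mult_monom)
qed

section \<open>Coordinates modulo the weight polynomial\<close>

text \<open>
In the trigonometric form the sum is \<open>catpoly r\<close> times \<open>2 cos (j \<phi>)\<close>, and \<open>2 cos (j \<phi>)\<close> is a polynomial
in \<open>x = 2 + 2 cos \<phi>\<close>.  The induction uses that both sequences satisfy the same recurrence in \<open>j\<close>.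
\<close>

lemma catpoly_reflect:
  assumes "j \<le> r"
  shows "catpoly r dvd catpoly (r + j) + catpoly (r - j)"
  using assms
proof (induction j rule: catpoly.induct)
  case 1
  show ?case
    by (simp flip: mult_2)
next
  case 2
  then obtain k where "r = Suc k"
    by (cases r) auto
  then show ?case
    by (simp del: mult_pCons_left)
next
  case (3 j)
  define i where "i = r - Suc (Suc j)"
  have r: "r - j = Suc (Suc i)" "r - Suc j = Suc i"
    using 3(3) by (simp_all add: i_def)
  have "catpoly (r + Suc (Suc j)) + catpoly i =
      [:- 2, 1:] * (catpoly (r + Suc j) + catpoly (r - Suc j)) - (catpoly (r + j) + catpoly (r - j))"
    by (simp add: r algebra_simps del: mult_pCons_left)
  moreover have "catpoly r dvd catpoly (r + j) + catpoly (r - j)"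
    and "catpoly r dvd catpoly (r + Suc j) + catpoly (r - Suc j)"
    using 3 by simp_all
  ultimately show ?case
    unfolding i_def by (metis dvd_diff dvd_mult)
qed

text \<open>
At a root of \<open>catpoly r\<close> the angle \<open>(2r + 1) \<phi>\<close> is a multiple of \<open>2\<pi>\<close>.  Algebraically, two consecutive
values determine a solution of the recurrence, and for \<open>k = 0, 1\<close> the claim follows by reflection at \<open>r\<close>.
\<close>

lemma catpoly_period: "catpoly r dvd catpoly (k + 2 * r + 1) - catpoly k"
proof -
  define t :: "rat poly" where "t = [:- 2, 1:]"
  have c0: "catpoly 0 = 1" and c1: "catpoly (Suc 0) = t + 1"
    and rec: "catpoly (Suc (Suc i)) = t * catpoly (Suc i) - catpoly i" for i
    by (simp_all add: t_def one_pCons)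
  have base: "catpoly r dvd catpoly (Suc (r + r)) - 1"
  proof (cases r)
    case (Suc j)
    have "catpoly (Suc (r + r)) - 1 =
        t * (catpoly (r + r) + catpoly (r - r)) - (catpoly (r + j) + catpoly (r - j))"
      by (simp add: Suc c1 rec algebra_simps del: catpoly.simps(2,3))
    moreover have "catpoly r dvd catpoly (r + j) + catpoly (r - j)"
      using Suc by (intro catpoly_reflect) simp
    ultimately show ?thesis
      using catpoly_reflect[of r r] by (simp only: dvd_diff dvd_mult)
  qed simp
  show ?thesis
  proof (induction k rule: catpoly.induct)
    case 1
    show ?case
      using base by (simp add: mult_2)
  next
    case 2
    have "catpoly (Suc 0 + 2 * r + 1) = t * catpoly (Suc (r + r)) - catpoly (r + r)"
      by (simp add: rec mult_2 del: catpoly.simps)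
    then have "catpoly (Suc 0 + 2 * r + 1) - catpoly (Suc 0) =
        t * (catpoly (Suc (r + r)) - 1) - (catpoly (r + r) + catpoly (r - r))"
      by (simp only: c0 c1 diff_self_eq_0) (simp add: right_diff_distrib)
    then show ?case
      using base catpoly_reflect[of r r] by (simp only: dvd_diff dvd_mult)
  next
    case (3 k)
    have "catpoly (Suc (Suc k) + 2 * r + 1) - catpoly (Suc (Suc k)) =
        t * (catpoly (Suc k + 2 * r + 1) - catpoly (Suc k)) - (catpoly (k + 2 * r + 1) - catpoly k)"
      by (simp add: rec algebra_simps del: catpoly.simps)
    then show ?case
      using 3 by (metis dvd_diff dvd_mult)
  qed
qed

lemma catpoly_mod_4:
  assumes "s < 4"
  shows "catpoly (9 * m + s) mod catpoly 4 = catpoly s"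
proof (induction m)
  case 0
  show ?case
    using assms by (simp add: mod_poly_less catpoly_monic)
next
  case (Suc m)
  have "catpoly (9 * Suc m + s) mod catpoly 4 = catpoly (9 * m + s) mod catpoly 4"
    using catpoly_period[of 4 "9 * m + s"] by (simp add: mod_eq_dvd_iff add_ac)
  then show ?case
    using Suc by simp
qed

lemma catpoly_mod_4_reflect:
  assumes "j \<le> 4"
  shows "catpoly (9 * m + 4 + j) mod catpoly 4 = - (catpoly (4 - j) mod catpoly 4)"
proof (induction m)
  case 0
  have "catpoly (4 + j) mod catpoly 4 = (- catpoly (4 - j)) mod catpoly 4"
    unfolding mod_eq_dvd_iff using catpoly_reflect[OF assms] by simp
  then show ?case
    by (simp add: poly_mod_minus_left)
next
  case (Suc m)
  have "catpoly (9 * Suc m + 4 + j) mod catpoly 4 = catpoly (9 * m + 4 + j) mod catpoly 4"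
    using catpoly_period[of 4 "9 * m + 4 + j"] by (simp add: mod_eq_dvd_iff add_ac)
  then show ?case
    using Suc by simp
qed

text \<open>
Coordinates of a polynomial of degree at most 3 in the basis \<open>p\<^sub>0, p\<^sub>1, p\<^sub>2, p\<^sub>3\<close>.  The numbers come from
\<open>x = p\<^sub>1 + p\<^sub>0\<close>, \<open>x\<^sup>2 = p\<^sub>2 + 3 p\<^sub>1 + 2 p\<^sub>0\<close> and \<open>x\<^sup>3 = p\<^sub>3 + 5 p\<^sub>2 + 9 p\<^sub>1 + 5 p\<^sub>0\<close>.
\<close>

definition mod_coords :: "rat poly \<Rightarrow> rat list" where
  "mod_coords r = [coeff r 0 + coeff r 1 + 2 * coeff r 2 + 5 * coeff r 3,
     coeff r 1 + 3 * coeff r 2 + 9 * coeff r 3, coeff r 2 + 5 * coeff r 3, coeff r 3]"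

definition low_coeffs :: "rat poly \<Rightarrow> rat list" where
  "low_coeffs f = [coeff f 0, coeff f 1, coeff f 2, coeff f 3]"

text \<open>
Coordinates modulo \<open>q = x\<^sup>4 p\<^sub>4\<close>.  The part modulo \<open>p\<^sub>4\<close> comes first because its columns are sparse and
should be expanded first.
\<close>

definition coords :: "rat poly \<Rightarrow> rat list" where
  "coords f = mod_coords (f mod catpoly 4) @ low_coeffs f"

lemma catpoly_1: "catpoly 1 = [:- 1, 1:]"
  and catpoly_2: "catpoly 2 = [:1, - 3, 1:]"
  and catpoly_3: "catpoly 3 = [:- 1, 6, - 5, 1:]"
  by (simp_all add: eval_nat_numeral one_pCons)

lemma mod_coords_catpoly:
  "mod_coords (catpoly 0) = [1, 0, 0, 0]"
  "mod_coords (catpoly 1) = [0, 1, 0, 0]"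
  "mod_coords (catpoly 2) = [0, 0, 1, 0]"
  "mod_coords (catpoly 3) = [0, 0, 0, 1]"
  unfolding mod_coords_def catpoly_1 catpoly_2 catpoly_3 by (simp_all add: eval_nat_numeral)

lemma mod_coords_uminus: "mod_coords (- r) = map uminus (mod_coords r)"
  by (simp add: mod_coords_def)

lemma mod_coords_0: "mod_coords 0 = [0, 0, 0, 0]"
  by (simp add: mod_coords_def)

lemma catpoly_mod_4_small: "s < 4 \<Longrightarrow> catpoly s mod catpoly 4 = catpoly s"
  by (simp add: mod_poly_less catpoly_monic)

lemma length_low_coeffs: "length (low_coeffs f) = Suc (Suc (Suc (Suc 0)))"
  by (simp add: low_coeffs_def)

lemma coords_catpoly:
  "coords (catpoly (9 * m)) = [1, 0, 0, 0] @ low_coeffs (catpoly (9 * m))"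
  "coords (catpoly (9 * m + 1)) = [0, 1, 0, 0] @ low_coeffs (catpoly (9 * m + 1))"
  "coords (catpoly (9 * m + 2)) = [0, 0, 1, 0] @ low_coeffs (catpoly (9 * m + 2))"
  "coords (catpoly (9 * m + 3)) = [0, 0, 0, 1] @ low_coeffs (catpoly (9 * m + 3))"
  "coords (catpoly (9 * m + 5)) = [0, 0, 0, - 1] @ low_coeffs (catpoly (9 * m + 5))"
  "coords (catpoly (9 * m + 6)) = [0, 0, - 1, 0] @ low_coeffs (catpoly (9 * m + 6))"
  "coords (catpoly (9 * m + 7)) = [0, - 1, 0, 0] @ low_coeffs (catpoly (9 * m + 7))"
  "coords (catpoly (9 * m + 8)) = [- 1, 0, 0, 0] @ low_coeffs (catpoly (9 * m + 8))"
  using catpoly_mod_4[of 0 m] catpoly_mod_4[of 1 m] catpoly_mod_4[of 2 m] catpoly_mod_4[of 3 m]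
    catpoly_mod_4_reflect[of 1 m] catpoly_mod_4_reflect[of 2 m]
    catpoly_mod_4_reflect[of 3 m] catpoly_mod_4_reflect[of 4 m]
  by (simp_all add: coords_def mod_coords_catpoly mod_coords_catpoly(2)[unfolded One_nat_def] mod_coords_uminus
      catpoly_mod_4_small add_ac
      del: catpoly.simps One_nat_def add_2_eq_Suc add_2_eq_Suc')

lemma coords_multiple:
  assumes "catpoly 4 dvd g"
  shows "coords (monom 1 0 * g) = [0, 0, 0, 0, coeff g 0, coeff g 1, coeff g 2, coeff g 3]"
    "coords (monom 1 1 * g) = [0, 0, 0, 0, 0, coeff g 0, coeff g 1, coeff g 2]"
    "coords (monom 1 2 * g) = [0, 0, 0, 0, 0, 0, coeff g 0, coeff g 1]"
    "coords (monom 1 3 * g) = [0, 0, 0, 0, 0, 0, 0, coeff g 0]"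
proof -
  have "monom 1 j * g mod catpoly 4 = 0" for j
    using assms by simp
  moreover have "g mod catpoly 4 = 0"
    using assms by simp
  ultimately show "coords (monom 1 0 * g) = [0, 0, 0, 0, coeff g 0, coeff g 1, coeff g 2, coeff g 3]"
    "coords (monom 1 1 * g) = [0, 0, 0, 0, 0, coeff g 0, coeff g 1, coeff g 2]"
    "coords (monom 1 2 * g) = [0, 0, 0, 0, 0, 0, coeff g 0, coeff g 1]"
    "coords (monom 1 3 * g) = [0, 0, 0, 0, 0, 0, 0, coeff g 0]"
    by (simp_all add: coords_def mod_coords_0 low_coeffs_def coeff_monom_mult)
qed

text \<open>
The polynomials at the centres of the antisymmetry modulo \<open>p\<^sub>4\<close>; they are multiples of \<open>p\<^sub>4\<close>.
\<close>

definition mid :: "nat \<Rightarrow> rat poly" where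
  "mid m = catpoly (9 * m + 4)"

text \<open>
The antisymmetry modulo \<open>p\<^sub>4\<close> and the period 9 also make \<open>p\<^sub>k\<close> antisymmetric about \<open>k = 9m + 17/2\<close>.
This is the sum of the two polynomials next to that centre; besides \<open>p\<^sub>4\<close> it is divisible by \<open>x\<close>,
since \<open>p\<^sub>k(0) = (-1)\<^sup>k\<close>.
\<close>

definition mirror_sum :: "nat \<Rightarrow> rat poly" where
  "mirror_sum m = catpoly (9 * m + 9) + catpoly (9 * m + 8)"

lemma mid_dvd: "catpoly 4 dvd mid m"
  using catpoly_mod_4_reflect[of 0 m] by (simp add: mid_def mod_eq_0_iff_dvd)

lemma mirror_sum_dvd: "catpoly 4 dvd mirror_sum m"
proof -
  have "mirror_sum m mod catpoly 4 = (catpoly 0 + - catpoly 0) mod catpoly 4"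
    unfolding mirror_sum_def
    by (rule mod_add_cong) (use catpoly_mod_4[of 0 "Suc m"] catpoly_mod_4_reflect[of 4 m] in
      \<open>simp_all add: mod_poly_less catpoly_monic add_ac del: catpoly.simps\<close>)
  then show ?thesis
    by (simp add: mod_eq_0_iff_dvd)
qed

lemma linear_coords:
  assumes "l < 8"
  shows "linear_functional (\<lambda>f. coords f ! l)"
proof -
  have "l \<in> {0, 1, 2, 3, 4, 5, 6, 7}"
    using assms by auto
  then show ?thesis
    unfolding linear_functional_def coords_def mod_coords_def low_coeffs_def
    by (auto simp: poly_mod_add_left mod_smult_left algebra_simps)
qed

lemma coords_weight_multiple:
  assumes "l < 8"
  shows "coords (f * (monom 1 4 * catpoly 4)) ! l = 0"
proof -
  have "l \<in> {0, 1, 2, 3, 4, 5, 6, 7}"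
    using assms by auto
  moreover have "monom 1 4 * (f * catpoly 4) mod catpoly 4 = 0"
    by simp
  moreover have "f * (monom 1 4 * catpoly 4) = monom 1 4 * (f * catpoly 4)"
    by (simp add: mult_ac)
  ultimately show ?thesis
    by (elim insertE emptyE) (simp_all only:, simp_all add: coords_def mod_coords_0 low_coeffs_def coeff_monom_mult)
qed

text \<open>
The polynomials of degree \<open>k\<close> that are admissible in Christoffel's formula of order \<open>n\<close>.
\<close>

definition orth_monic :: "nat \<Rightarrow> nat \<Rightarrow> rat poly \<Rightarrow> bool" where
  "orth_monic n k g \<longleftrightarrow> degree g = k \<and> coeff g k = 1 \<and>
     (\<forall>l<n. catalan_functional (monom 1 l * g) = 0)"

lemma orth_monic_catpoly: "n \<le> k \<Longrightarrow> k' = k \<Longrightarrow> orth_monic n k' (catpoly k)"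
  by (simp add: orth_monic_def catpoly_monic catpoly_orthogonal)

lemma orth_monic_shift:
  assumes "orth_monic (n + j) k g"
  shows "orth_monic n (k + j) (monom 1 j * g)"
proof -
  have "g \<noteq> 0"
    using assms by (auto simp: orth_monic_def)
  then show ?thesis
    using assms
    by (auto simp: orth_monic_def degree_mult_eq degree_monom_eq coeff_monom_mult mult.assoc[symmetric]
        mult_monom)
qed

lemma orth_monic_mid: "n + j \<le> 9 * m + 4 \<Longrightarrow> k = 9 * m + 4 + j \<Longrightarrow> orth_monic n k (monom 1 j * mid m)"
  unfolding mid_def by (simp add: orth_monic_shift orth_monic_catpoly)

lemma orth_monic_mirror_sum:
  assumes "n + j \<le> 9 * m + 8" "k = 9 * m + 9 + j"
  shows "orth_monic n k (monom 1 j * mirror_sum m)"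
proof -
  have "orth_monic (n + j) (9 * m + 9) (mirror_sum m)"
    using assms(1) unfolding orth_monic_def mirror_sum_def
    by (auto simp: catpoly_monic degree_add_eq_left coeff_eq_0 distrib_left catalan_functional_add
        catpoly_orthogonal)
  then show ?thesis
    using assms(2) orth_monic_shift by blast
qed

text \<open>
In general the coefficient of \<open>x\<^sup>j\<close> is \<open>(-1)^(k + j) (k + j choose 2j)\<close>; it is
written out as a polynomial in \<open>k\<close> because the final identities are polynomial identities.
\<close>

lemma coeff_catpoly:
  "coeff (catpoly k) 0 = (-1) ^ k"
  "coeff (catpoly k) 1 = - ((-1) ^ k * (of_nat k * (of_nat k + 1) / 2))"
  "coeff (catpoly k) 2 = (-1) ^ k * ((of_nat k - 1) * of_nat k * (of_nat k + 1) * (of_nat k + 2) / 24)"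
  "coeff (catpoly k) 3 = - ((-1) ^ k * ((of_nat k - 2) * (of_nat k - 1) * of_nat k *
     (of_nat k + 1) * (of_nat k + 2) * (of_nat k + 3) / 720))"
proof -
  have rec0: "coeff ([:- 2, 1:] * f - g) 0 = - 2 * coeff f 0 - coeff g 0"
    and rec: "coeff ([:- 2, 1:] * f - g) (Suc i) = coeff f i - 2 * coeff f (Suc i) - coeff g (Suc i)"
    for f g :: "rat poly" and i
    by simp_all
  have 0: "coeff (catpoly k) 0 = (-1) ^ k" for k
    by (induction k rule: catpoly.induct) (simp, simp, simp only: catpoly.simps rec0, simp)
  have 1: "coeff (catpoly k) (Suc 0) = - ((-1) ^ k * (of_nat k * (of_nat k + 1) / 2))" for k
    by (induction k rule: catpoly.induct)
       (simp, simp, simp only: catpoly.simps rec 0, simp add: field_simps)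
  have 2: "coeff (catpoly k) (Suc (Suc 0)) =
      (-1) ^ k * ((of_nat k - 1) * of_nat k * (of_nat k + 1) * (of_nat k + 2) / 24)" for k
    by (induction k rule: catpoly.induct)
       (simp, simp, simp only: catpoly.simps rec 1, simp add: field_simps)
  have 3: "coeff (catpoly k) (Suc (Suc (Suc 0))) = - ((-1) ^ k * ((of_nat k - 2) * (of_nat k - 1) *
      of_nat k * (of_nat k + 1) * (of_nat k + 2) * (of_nat k + 3) / 720))" for k
    by (induction k rule: catpoly.induct)
       (simp, simp, simp only: catpoly.simps rec 2, simp add: field_simps)
  show "coeff (catpoly k) 0 = (-1) ^ k"
  "coeff (catpoly k) 1 = - ((-1) ^ k * (of_nat k * (of_nat k + 1) / 2))"
  "coeff (catpoly k) 2 = (-1) ^ k * ((of_nat k - 1) * of_nat k * (of_nat k + 1) * (of_nat k + 2) / 24)"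
  "coeff (catpoly k) 3 = - ((-1) ^ k * ((of_nat k - 2) * (of_nat k - 1) * of_nat k *
     (of_nat k + 1) * (of_nat k + 2) * (of_nat k + 3) / 720))"
    using 0[of k] 1[of k] 2[of k] 3[of k] by (simp_all add: numeral_2_eq_2 numeral_3_eq_3)
qed

lemma list_det_map_coords:
  assumes "length gs = 8"
  shows "list_det (map coords gs) = det (mat 8 8 (\<lambda>(i, l). coords (gs ! i) ! l))"
  unfolding list_det_def using assms by (intro arg_cong[of _ _ det] eq_matI) auto

text \<open>
Christoffel's formula with \<open>d = 8\<close>.  The normalising determinant of the formula is computed on the basis
\<open>p\<^sub>0, p\<^sub>1, p\<^sub>2, p\<^sub>3, p\<^sub>4, x p\<^sub>4, x\<^sup>2 p\<^sub>4, x\<^sup>3 p\<^sub>4\<close> of the quotient, where it is 1 because \<open>p\<^sub>4(0) = 1\<close>.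
\<close>

lemma hankel_det_F_9:
  assumes "orth_monic n n g0" "orth_monic n (n + 1) g1" "orth_monic n (n + 2) g2"
    "orth_monic n (n + 3) g3" "orth_monic n (n + 4) g4" "orth_monic n (n + 5) g5"
    "orth_monic n (n + 6) g6" "orth_monic n (n + 7) g7"
  shows "hankel_det n (F 9) = list_det (map coords [g0, g1, g2, g3, g4, g5, g6, g7])"
proof -
  let ?g = "[g0, g1, g2, g3, g4, g5, g6, g7]"
  let ?e = "[catpoly (9 * 0), catpoly (9 * 0 + 1), catpoly (9 * 0 + 2), catpoly (9 * 0 + 3),
    monom 1 0 * mid 0, monom 1 1 * mid 0, monom 1 2 * mid 0, monom 1 3 * mid 0]"
  define p where "p k = (if k < n then catpoly k else ?g ! (k - n))" for k
  have cases8: "i \<in> {0, 1, 2, 3, 4, 5, 6, 7}" if "i < 8" for i :: nat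
    using that by auto
  have g: "orth_monic n (n + i) (?g ! i)" if "i < 8" for i
    using cases8[OF that] assms by auto
  have e: "orth_monic 0 i (?e ! i)" if "i < 8" for i
    using cases8[OF that] by (elim insertE emptyE)
      (simp_all add: orth_monic_catpoly orth_monic_mid orth_monic_mid[where j = 0, simplified]
        del: catpoly.simps)
  have p: "degree (p k) = k \<and> coeff (p k) k = 1" and
    orth: "l < n \<Longrightarrow> l < k \<Longrightarrow> catalan_functional (monom 1 l * p k) = 0" if "k < n + 8" for k l
    using that g[of "k - n"] by (auto simp: p_def catpoly_monic catpoly_orthogonal orth_monic_def)
  have q: "degree (monom 1 4 * catpoly 4) = 8" "coeff (monom 1 4 * catpoly 4) 8 = 1"
    using orth_monic_mid[of 0 4 0 8] by (simp_all add: orth_monic_def mid_def)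
  have "det (mat 8 8 (\<lambda>(i, l). coords (p (n + i)) ! l)) =
      (-1) ^ (8 * n) * det (mat 8 8 (\<lambda>(i, l). coords (?e ! i) ! l)) * hankel_det n (F 9)"
    unfolding F_eq_functional
    by (rule christoffel_hankel_det)
       (use linear_catalan_functional linear_coords coords_weight_multiple q p orth e catpoly_norm
        in \<open>auto simp: orth_monic_def p_def\<close>)
  moreover have "mat 8 8 (\<lambda>(i, l). coords (p (n + i)) ! l) = mat 8 8 (\<lambda>(i, l). coords (?g ! i) ! l)"
    by (rule eq_matI) (auto simp: p_def)
  moreover have "list_det (map coords ?e) = 1"
    unfolding list.map coords_catpoly[of 0] coords_multiple[OF mid_dvd[of 0]] append.simps
    by (simp only: list_det_simps length_low_coeffs)
       (simp add: mid_def coeff_catpoly del: catpoly.simps)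
  ultimately show ?thesis
    by (simp only: list_det_map_coords length_Cons list.size) (simp add: list_det_map_coords)
qed

section \<open>The nine residue classes\<close>

text \<open>
In each residue class \<open>n = 9m + r\<close> the eight polynomials of degrees \<open>n, \<dots>, n + 7\<close> are taken from three
kinds: \<open>x\<^sup>j mid\<close> and \<open>x\<^sup>j mirror_sum\<close>, which vanish modulo \<open>p\<^sub>4\<close>, and single \<open>p\<^sub>k\<close>, which are \<open>\<plusminus>p\<^sub>i\<close> modulo
\<open>p\<^sub>4\<close>.  A power \<open>x\<^sup>j\<close> lowers the order of orthogonality by \<open>j\<close>, so it is admissible only as long as \<open>n + j\<close>
does not exceed the order of orthogonality of the factor (\<open>9m + 4\<close> or \<open>9m + 8\<close>).  For \<open>r \<ge> 6\<close> the
topmost degrees are taken from the next period \<open>Suc m\<close>.  Expanding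
along the first four columns deletes the rows of the single \<open>p\<^sub>k\<close>; what remains is a \<open>4 \<times> 4\<close> determinant
whose rows are shifts of the low-order coefficients of \<open>mid\<close> and \<open>mirror_sum\<close>.  For \<open>r = 4\<close> and \<open>r = 6\<close>
it is triangular up to the order of its rows, with the linear coefficient of \<open>mirror_sum\<close> three times on the diagonal; hence the cubes.
All coefficients carry the sign \<open>(-1)^m\<close>; each of its two values leaves a polynomial identity in \<open>m\<close>.
\<close>

lemma coeff_mid:
  "coeff (mid m) 0 = (-1) ^ m"
  "coeff (mid m) 1 = - ((-1) ^ m * ((9 * of_nat m + 4) * (9 * of_nat m + 5) / 2))"
  "coeff (mid m) 2 = (-1) ^ m *
     ((9 * of_nat m + 3) * (9 * of_nat m + 4) * (9 * of_nat m + 5) * (9 * of_nat m + 6) / 24)"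
  "coeff (mid m) 3 = - ((-1) ^ m *
     ((9 * of_nat m + 2) * (9 * of_nat m + 3) * (9 * of_nat m + 4) *
      (9 * of_nat m + 5) * (9 * of_nat m + 6) * (9 * of_nat m + 7) / 720))"
  unfolding mid_def coeff_catpoly by (simp_all add: power_add power_mult add_ac)

lemma coeff_mirror_sum:
  "coeff (mirror_sum m) 0 = 0"
  "coeff (mirror_sum m) 1 = (-1) ^ m * (9 * (of_nat m + 1))"
  "coeff (mirror_sum m) 2 = - ((-1) ^ m *
     ((9 * of_nat m + 8) * (9 * of_nat m + 9) * (9 * of_nat m + 10) / 6))"
  "coeff (mirror_sum m) 3 = (-1) ^ m *
     ((9 * of_nat m + 7) * (9 * of_nat m + 8) * (9 * of_nat m + 9) *
      (9 * of_nat m + 10) * (9 * of_nat m + 11) / 120)"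
proof -
  have sign: "(-1) ^ (9 * m + 9) = - ((-1) ^ m :: rat)" "(-1) ^ (9 * m + 8) = ((-1) ^ m :: rat)"
    by (simp_all add: power_add power_mult)
  show "coeff (mirror_sum m) 0 = 0"
  "coeff (mirror_sum m) 1 = (-1) ^ m * (9 * (of_nat m + 1))"
  "coeff (mirror_sum m) 2 = - ((-1) ^ m *
     ((9 * of_nat m + 8) * (9 * of_nat m + 9) * (9 * of_nat m + 10) / 6))"
  "coeff (mirror_sum m) 3 = (-1) ^ m *
     ((9 * of_nat m + 7) * (9 * of_nat m + 8) * (9 * of_nat m + 9) *
      (9 * of_nat m + 10) * (9 * of_nat m + 11) / 120)"
    unfolding mirror_sum_def coeff_add coeff_catpoly sign by (simp_all add: field_simps)
qed

lemma minus_one_power_cases: "(-1) ^ m = (1 :: rat) \<or> (-1) ^ m = (-1 :: rat)"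
  by (cases "even m") auto

lemmas orth_monic_intros = orth_monic_catpoly orth_monic_mid orth_monic_mirror_sum

lemmas coords_simps = coords_catpoly coords_multiple[OF mid_dvd] coords_multiple[OF mirror_sum_dvd]

lemma hankel_det_F_9_0:
  "hankel_det (9 * m) (F 9) = 1"
proof -
  have "hankel_det (9 * m) (F 9) = list_det (map coords
      [catpoly (9 * m), catpoly (9 * m + 1), catpoly (9 * m + 2), catpoly (9 * m + 3),
       monom 1 0 * mid m, monom 1 1 * mid m, monom 1 2 * mid m, monom 1 3 * mid m])"
    by (rule hankel_det_F_9; rule orth_monic_intros; simp)
  then show ?thesis
    unfolding list.map coords_simps append.simps
    using minus_one_power_cases[of m]
    by (simp only: list_det_simps length_low_coeffs coeff_mid coeff_mirror_sum power_Suc, elim disjE)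
       (simp_all add: field_simps power2_eq_square power3_eq_cube power4_eq_xxxx)
qed

lemma hankel_det_F_9_1:
  "hankel_det (9 * m + 1) (F 9) = 1"
proof -
  have "hankel_det (9 * m + 1) (F 9) = list_det (map coords
      [catpoly (9 * m + 1), catpoly (9 * m + 2), catpoly (9 * m + 3),
       monom 1 0 * mid m, monom 1 1 * mid m, monom 1 2 * mid m, monom 1 3 * mid m,
       catpoly (9 * m + 8)])"
    by (rule hankel_det_F_9; rule orth_monic_intros; simp)
  then show ?thesis
    unfolding list.map coords_simps append.simps
    using minus_one_power_cases[of m]
    by (simp only: list_det_simps length_low_coeffs coeff_mid coeff_mirror_sum power_Suc, elim disjE)
       (simp_all add: field_simps power2_eq_square power3_eq_cube power4_eq_xxxx)
qed

lemma hankel_det_F_9_2: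
  "hankel_det (9 * m + 2) (F 9) = - (27 / 10) * (3 * of_nat m + 2) * (18 * of_nat m + 1) *
     (of_nat m + 1) * (54 * of_nat m ^ 2 + 42 * of_nat m + 5)"
proof -
  have "hankel_det (9 * m + 2) (F 9) = list_det (map coords
      [catpoly (9 * m + 2), catpoly (9 * m + 3),
       monom 1 0 * mid m, monom 1 1 * mid m, monom 1 2 * mid m,
       catpoly (9 * m + 7), catpoly (9 * m + 8), monom 1 0 * mirror_sum m])"
    by (rule hankel_det_F_9; rule orth_monic_intros; simp)
  then show ?thesis
    unfolding list.map coords_simps append.simps
    using minus_one_power_cases[of m]
    by (simp only: list_det_simps length_low_coeffs coeff_mid coeff_mirror_sum power_Suc, elim disjE)
       (simp_all add: field_simps power2_eq_square power3_eq_cube power4_eq_xxxx)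
qed

lemma hankel_det_F_9_3:
  "hankel_det (9 * m + 3) (F 9) = 9 / 20 * (of_nat m + 1) ^ 2 *
     (26244 * of_nat m ^ 4 + 104976 * of_nat m ^ 3 + 108459 * of_nat m ^ 2 +
      31266 * of_nat m - 1460)"
proof -
  have "hankel_det (9 * m + 3) (F 9) = list_det (map coords
      [catpoly (9 * m + 3),
       monom 1 0 * mid m, monom 1 1 * mid m,
       catpoly (9 * m + 6), catpoly (9 * m + 7), catpoly (9 * m + 8),
       monom 1 0 * mirror_sum m, monom 1 1 * mirror_sum m])"
    by (rule hankel_det_F_9; rule orth_monic_intros; simp)
  then show ?thesis
    unfolding list.map coords_simps append.simps
    using minus_one_power_cases[of m]
    by (simp only: list_det_simps length_low_coeffs coeff_mid coeff_mirror_sum power_Suc, elim disjE)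
       (simp_all add: field_simps power2_eq_square power3_eq_cube power4_eq_xxxx)
qed

lemma hankel_det_F_9_4:
  "hankel_det (9 * m + 4) (F 9) = (9 * (of_nat m + 1)) ^ 3"
proof -
  have "hankel_det (9 * m + 4) (F 9) = list_det (map coords
      [monom 1 0 * mid m,
       catpoly (9 * m + 5), catpoly (9 * m + 6), catpoly (9 * m + 7), catpoly (9 * m + 8),
       monom 1 0 * mirror_sum m, monom 1 1 * mirror_sum m, monom 1 2 * mirror_sum m])"
    by (rule hankel_det_F_9; rule orth_monic_intros; simp)
  then show ?thesis
    unfolding list.map coords_simps append.simps
    using minus_one_power_cases[of m]
    by (simp only: list_det_simps length_low_coeffs coeff_mid coeff_mirror_sum power_Suc, elim disjE)
       (simp_all add: field_simps power2_eq_square power3_eq_cube power4_eq_xxxx)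
qed

text \<open>
All four multiples of \<open>p\<^sub>4\<close> are here multiples of \<open>mirror_sum m\<close>, hence of \<open>x\<close>: a column vanishes.
\<close>

lemma hankel_det_F_9_5:
  "hankel_det (9 * m + 5) (F 9) = 0"
proof -
  have "hankel_det (9 * m + 5) (F 9) = list_det (map coords
      [catpoly (9 * m + 5), catpoly (9 * m + 6), catpoly (9 * m + 7), catpoly (9 * m + 8),
       monom 1 0 * mirror_sum m, monom 1 1 * mirror_sum m, monom 1 2 * mirror_sum m, monom 1 3 * mirror_sum m])"
    by (rule hankel_det_F_9; rule orth_monic_intros; simp)
  then show ?thesis
    unfolding list.map coords_simps append.simps
    by (simp only: list_det_simps length_low_coeffs coeff_mirror_sum)
qed

lemma hankel_det_F_9_6:
  "hankel_det (9 * m + 6) (F 9) = - ((9 * (of_nat m + 1)) ^ 3)"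
proof -
  have "hankel_det (9 * m + 6) (F 9) = list_det (map coords
      [catpoly (9 * m + 6), catpoly (9 * m + 7), catpoly (9 * m + 8),
       monom 1 0 * mirror_sum m, monom 1 1 * mirror_sum m, monom 1 2 * mirror_sum m,
       catpoly (9 * Suc m + 3), monom 1 0 * mid (Suc m)])"
    by (rule hankel_det_F_9; rule orth_monic_intros; simp)
  then show ?thesis
    unfolding list.map coords_simps append.simps
    using minus_one_power_cases[of m]
    by (simp only: list_det_simps length_low_coeffs coeff_mid coeff_mirror_sum power_Suc, elim disjE)
       (simp_all add: field_simps power2_eq_square power3_eq_cube power4_eq_xxxx)
qed

lemma hankel_det_F_9_7:
  "hankel_det (9 * m + 7) (F 9) = 9 / 20 * (of_nat m + 1) ^ 2 *
     (26244 * of_nat m ^ 4 + 104976 * of_nat m ^ 3 + 108459 * of_nat m ^ 2 -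
      17334 * of_nat m - 50060)"
proof -
  have "hankel_det (9 * m + 7) (F 9) = list_det (map coords
      [catpoly (9 * m + 7), catpoly (9 * m + 8),
       monom 1 0 * mirror_sum m, monom 1 1 * mirror_sum m,
       catpoly (9 * Suc m + 2), catpoly (9 * Suc m + 3),
       monom 1 0 * mid (Suc m), monom 1 1 * mid (Suc m)])"
    by (rule hankel_det_F_9; rule orth_monic_intros; simp)
  then show ?thesis
    unfolding list.map coords_simps append.simps
    using minus_one_power_cases[of m]
    by (simp only: list_det_simps length_low_coeffs coeff_mid coeff_mirror_sum power_Suc, elim disjE)
       (simp_all add: field_simps power2_eq_square power3_eq_cube power4_eq_xxxx)
qed

lemma hankel_det_F_9_8:
  "hankel_det (9 * m + 8) (F 9) = 27 / 10 * (18 * of_nat m + 35) * (3 * of_nat m + 4) *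
     (of_nat m + 1) * (54 * of_nat m ^ 2 + 174 * of_nat m + 137)"
proof -
  have "hankel_det (9 * m + 8) (F 9) = list_det (map coords
      [catpoly (9 * m + 8), monom 1 0 * mirror_sum m,
       catpoly (9 * Suc m + 1), catpoly (9 * Suc m + 2), catpoly (9 * Suc m + 3),
       monom 1 0 * mid (Suc m), monom 1 1 * mid (Suc m), monom 1 2 * mid (Suc m)])"
    by (rule hankel_det_F_9; rule orth_monic_intros; simp)
  then show ?thesis
    unfolding list.map coords_simps append.simps
    using minus_one_power_cases[of m]
    by (simp only: list_det_simps length_low_coeffs coeff_mid coeff_mirror_sum power_Suc, elim disjE)
       (simp_all add: field_simps power2_eq_square power3_eq_cube power4_eq_xxxx)
qed

theorem theorem13:
  fixes n :: nat
  shows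
    "hankel_det (9 * n) (F 9) = 1 \<and>
     hankel_det (9 * n + 1) (F 9) = 1 \<and>
     hankel_det (9 * n + 2) (F 9) =
       - (27 / 10) * (3 * of_nat n + 2) * (18 * of_nat n + 1) * (of_nat n + 1)
         * (54 * of_nat n ^ 2 + 42 * of_nat n + 5) \<and>
     hankel_det (9 * n + 3) (F 9) =
       9 / 20 * (of_nat n + 1) ^ 2
         * (26244 * of_nat n ^ 4 + 104976 * of_nat n ^ 3 + 108459 * of_nat n ^ 2
            + 31266 * of_nat n - 1460) \<and>
     hankel_det (9 * n + 4) (F 9) = (9 * (of_nat n + 1)) ^ 3 \<and>
     - hankel_det (9 * n + 6) (F 9) = (9 * (of_nat n + 1)) ^ 3 \<and>
     hankel_det (9 * n + 5) (F 9) = 0 \<and>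
     hankel_det (9 * n + 7) (F 9) =
       9 / 20 * (of_nat n + 1) ^ 2
         * (26244 * of_nat n ^ 4 + 104976 * of_nat n ^ 3 + 108459 * of_nat n ^ 2
            - 17334 * of_nat n - 50060) \<and>
     hankel_det (9 * n + 8) (F 9) =
       27 / 10 * (18 * of_nat n + 35) * (3 * of_nat n + 4) * (of_nat n + 1)
         * (54 * of_nat n ^ 2 + 174 * of_nat n + 137)"
  using hankel_det_F_9_0[of n] hankel_det_F_9_1[of n] hankel_det_F_9_2[of n]
    hankel_det_F_9_3[of n] hankel_det_F_9_4[of n] hankel_det_F_9_5[of n]
    hankel_det_F_9_6[of n] hankel_det_F_9_7[of n] hankel_det_F_9_8[of n]
  by simp

end
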